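(* (1) Let $m\in\mathbb{Z}_+$ and suppose $V$ is a simple $F_{[m]}$-module such that $zV=0$. Then $F_{[m]}V=0$. Consequently $\dim V=1$. (2) Let $\delta\in\{0,\tfrac12\}$ and suppose $V$ is a simple $F(\delta)$-module such that $zV=0$. Then $F(\delta)V=0$. Consequently $\dim V=1$.
   Context: All vector spaces and algebras are over $\mathbb{C}$; $\mathbb{Z}_+$ is the set of non-negative integers. Modules over Lie superalgebras are $\mathbb{Z}_2$-graded, and simple means having no nonzero proper graded submodule. For $\delta\in\{0,\frac12\}$ the Fermion algebra $F(\delta)$ is the Lie superalgebra with basis $\{\psi_m, z: m\in\mathbb{Z}+\delta\}$, where the $\psi_m$ are odd and $z$ is even, and brackets $[\psi_m,\psi_n]=\delta_{m,-n}z$ ($\delta_{m,-n}$ the Kronecker symbol), $[F(\delta),z]=0$. For $m\in\mathbb{Z}_+$, $F_{[m]}=\bigoplus_{i=-m}^m\mathbb{C}\psi_i\oplus\mathbb{C}z$ is a subalgebra of $F(0)$. *)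

theory Defs
  imports Complex_Main "HOL-Library.Poly_Mapping" "HOL-Library.Z2"
begin

section \<open>Lie superalgebras and their modules\<close>

text \<open>
  A superspace is given by its two homogeneous components, indexed by the parity in
  \<^typ>\<open>bit\<close> = Z/2Z; the underlying vector space is their (direct) sum
  \<open>super_carrier V\<close>, which need not be the whole ambient type.
\<close>

definition super_carrier :: "(bit \<Rightarrow> 'v::ab_group_add set) \<Rightarrow> 'v set" where
  "super_carrier V = {a + b | a b. a \<in> V 0 \<and> b \<in> V 1}"

text \<open>The sign $(-1)^{ij}$.\<close>

definition super_sign :: "bit \<Rightarrow> bit \<Rightarrow> complex" where
  "super_sign i j = (if i = 1 \<and> j = 1 then -1 else 1)"

locale superspace = vector_space scale
  for scale :: "complex \<Rightarrow> 'v::ab_group_add \<Rightarrow> 'v" +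
  fixes V :: "bit \<Rightarrow> 'v set"
  assumes subspace_component: "subspace (V i)"
    and components_disjoint: "V 0 \<inter> V 1 = {0}"

locale lie_superalgebra = superspace scale G
  for scale :: "complex \<Rightarrow> 'g::ab_group_add \<Rightarrow> 'g" and G :: "bit \<Rightarrow> 'g set" +
  fixes bracket :: "'g \<Rightarrow> 'g \<Rightarrow> 'g"
  assumes bracket_add_left:
      "\<lbrakk>x \<in> super_carrier G; x' \<in> super_carrier G; y \<in> super_carrier G\<rbrakk>
        \<Longrightarrow> bracket (x + x') y = bracket x y + bracket x' y"
    and bracket_add_right:
      "\<lbrakk>x \<in> super_carrier G; y \<in> super_carrier G; y' \<in> super_carrier G\<rbrakk>
        \<Longrightarrow> bracket x (y + y') = bracket x y + bracket x y'"
    and bracket_scale_left: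
      "\<lbrakk>x \<in> super_carrier G; y \<in> super_carrier G\<rbrakk>
        \<Longrightarrow> bracket (scale c x) y = scale c (bracket x y)"
    and bracket_scale_right:
      "\<lbrakk>x \<in> super_carrier G; y \<in> super_carrier G\<rbrakk>
        \<Longrightarrow> bracket x (scale c y) = scale c (bracket x y)"
    and bracket_graded: "\<lbrakk>x \<in> G i; y \<in> G j\<rbrakk> \<Longrightarrow> bracket x y \<in> G (i + j)"
    and bracket_skew:
      "\<lbrakk>x \<in> G i; y \<in> G j\<rbrakk> \<Longrightarrow> bracket x y = - scale (super_sign i j) (bracket y x)"
    and bracket_jacobi:
      "\<lbrakk>x \<in> G i; y \<in> G j; z \<in> G k\<rbrakk>
        \<Longrightarrow> bracket x (bracket y z) =
            bracket (bracket x y) z + scale (super_sign i j) (bracket y (bracket x z))"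

locale lie_subsuperalgebra = lie_superalgebra scale G bracket
  for scale :: "complex \<Rightarrow> 'g::ab_group_add \<Rightarrow> 'g" and G bracket +
  fixes H :: "bit \<Rightarrow> 'g set"
  assumes sub_subspace: "subspace (H i)"
    and sub_component: "H i \<subseteq> G i"
    and sub_closed: "\<lbrakk>x \<in> super_carrier H; y \<in> super_carrier H\<rbrakk> \<Longrightarrow> bracket x y \<in> super_carrier H"

locale lie_supermodule =
  alg: lie_superalgebra gscale G bracket + superspace scale V
  for gscale :: "complex \<Rightarrow> 'g::ab_group_add \<Rightarrow> 'g"
    and G :: "bit \<Rightarrow> 'g set"
    and bracket :: "'g \<Rightarrow> 'g \<Rightarrow> 'g"
    and scale :: "complex \<Rightarrow> 'v::ab_group_add \<Rightarrow> 'v"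
    and V :: "bit \<Rightarrow> 'v set" +
  fixes act :: "'g \<Rightarrow> 'v \<Rightarrow> 'v"
  assumes act_add_left:
      "\<lbrakk>x \<in> super_carrier G; x' \<in> super_carrier G; v \<in> super_carrier V\<rbrakk>
        \<Longrightarrow> act (x + x') v = act x v + act x' v"
    and act_add_right:
      "\<lbrakk>x \<in> super_carrier G; v \<in> super_carrier V; v' \<in> super_carrier V\<rbrakk>
        \<Longrightarrow> act x (v + v') = act x v + act x v'"
    and act_scale_left:
      "\<lbrakk>x \<in> super_carrier G; v \<in> super_carrier V\<rbrakk>
        \<Longrightarrow> act (gscale c x) v = scale c (act x v)"
    and act_scale_right:
      "\<lbrakk>x \<in> super_carrier G; v \<in> super_carrier V\<rbrakk>
        \<Longrightarrow> act x (scale c v) = scale c (act x v)"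
    and act_graded: "\<lbrakk>x \<in> G i; v \<in> V j\<rbrakk> \<Longrightarrow> act x v \<in> V (i + j)"
    and act_bracket:
      "\<lbrakk>x \<in> G i; y \<in> G j; v \<in> super_carrier V\<rbrakk>
        \<Longrightarrow> act (bracket x y) v =
            act x (act y v) - scale (super_sign i j) (act y (act x v))"
begin

definition graded_submodule :: "'v set \<Rightarrow> bool" where
  "graded_submodule W \<longleftrightarrow>
     subspace W \<and> W \<subseteq> super_carrier V \<and> W = super_carrier (\<lambda>i. W \<inter> V i) \<and>
     (\<forall>x\<in>super_carrier G. \<forall>w\<in>W. act x w \<in> W)"

end

text \<open>As usual, a simple module is required to be nonzero.\<close>

locale simple_lie_supermodule = lie_supermodule +
  assumes nonzero: "super_carrier V \<noteq> {0}"
    and no_proper_submodule: "graded_submodule W \<Longrightarrow> W = {0} \<or> W = super_carrier V"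


section \<open>The Fermion algebras\<close>

text \<open>
  All Fermion algebras live in one ambient space: the free vector space, realised as finitely
  supported functions, on the symbols \<open>Psi r\<close> with \<open>r\<close> rational and the central symbol \<open>Zc\<close>.
  The bracket is the bilinear extension of its values on the symbols, and the individual
  algebras are cut out by restricting the set of admissible indices of the \<open>Psi\<close>.
\<close>

datatype fermion_basis = Psi rat | Zc

type_synonym fermion = "fermion_basis \<Rightarrow>\<^sub>0 complex"

definition fscale :: "complex \<Rightarrow> fermion \<Rightarrow> fermion" where
  "fscale c = Poly_Mapping.map ((*) c)"

definition psi :: "rat \<Rightarrow> fermion" where
  "psi r = Poly_Mapping.single (Psi r) 1"

definition fz :: fermion where
  "fz = Poly_Mapping.single Zc 1"

fun basis_bracket :: "fermion_basis \<Rightarrow> fermion_basis \<Rightarrow> fermion" where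
  "basis_bracket (Psi m) (Psi n) = (if m = - n then fz else 0)"
| "basis_bracket Zc _ = 0"
| "basis_bracket _ Zc = 0"

definition fbracket :: "fermion \<Rightarrow> fermion \<Rightarrow> fermion" where
  "fbracket f g =
     (\<Sum>a\<in>Poly_Mapping.keys f. \<Sum>b\<in>Poly_Mapping.keys g.
        fscale (Poly_Mapping.lookup f a * Poly_Mapping.lookup g b) (basis_bracket a b))"

definition fermion_comp :: "rat set \<Rightarrow> bit \<Rightarrow> fermion set" where
  "fermion_comp I i =
     {f. Poly_Mapping.keys f \<subseteq> (if i = 0 then {Zc} else Psi ` I)}"

definition fermion_alg :: "rat \<Rightarrow> bit \<Rightarrow> fermion set" where
  "fermion_alg \<delta> = fermion_comp {m. m - \<delta> \<in> \<int>}"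

definition fermion_fin :: "nat \<Rightarrow> bit \<Rightarrow> fermion set" where
  "fermion_fin m = fermion_comp {i. i \<in> \<int> \<and> \<bar>i\<bar> \<le> of_nat m}"


subsection \<open>They are Lie superalgebras\<close>

lemma lookup_fscale [simp]: "Poly_Mapping.lookup (fscale c f) a = c * Poly_Mapping.lookup f a"
  by (simp add: fscale_def Poly_Mapping.map.rep_eq when_def)

lemma vector_space_fscale: "vector_space fscale"
  by unfold_locales (auto intro!: poly_mapping_eqI simp: lookup_add algebra_simps)

interpretation F: vector_space fscale
  by (rule vector_space_fscale)

lemma keys_fscale: "Poly_Mapping.keys (fscale c f) \<subseteq> Poly_Mapping.keys f"
  by (auto simp: in_keys_iff)

lemma fbracket_superset:
  assumes "finite A" "Poly_Mapping.keys f \<subseteq> A" "finite B" "Poly_Mapping.keys g \<subseteq> B"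
  shows "fbracket f g =
    (\<Sum>a\<in>A. \<Sum>b\<in>B.
       fscale (Poly_Mapping.lookup f a * Poly_Mapping.lookup g b) (basis_bracket a b))"
proof -
  have "(\<Sum>b\<in>Poly_Mapping.keys g.
          fscale (Poly_Mapping.lookup f a * Poly_Mapping.lookup g b) (basis_bracket a b))
      = (\<Sum>b\<in>B. fscale (Poly_Mapping.lookup f a * Poly_Mapping.lookup g b) (basis_bracket a b))"
    for a
    using assms by (intro sum.mono_neutral_left) (auto simp: in_keys_iff)
  then show ?thesis
    unfolding fbracket_def using assms
    by (simp, intro sum.mono_neutral_left) (auto simp: in_keys_iff)
qed

lemma fbracket_psi: "fbracket (psi m) (psi n) = (if m = - n then fz else 0)"
  by (simp add: fbracket_def psi_def)

lemma fbracket_commute: "fbracket f g = fbracket g f"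
proof -
  have "basis_bracket a b = basis_bracket b a" for a b
    by (cases a; cases b) auto
  then show ?thesis
    unfolding fbracket_def by (subst sum.swap) (simp add: mult.commute)
qed

lemma fbracket_add: "fbracket (f + f') g = fbracket f g + fbracket f' g"
proof -
  let ?A = "Poly_Mapping.keys f \<union> Poly_Mapping.keys f'" and ?B = "Poly_Mapping.keys g"
  have "Poly_Mapping.keys (f + f') \<subseteq> ?A" by (rule Poly_Mapping.keys_add)
  then show ?thesis
    by (subst (1 2 3) fbracket_superset[of ?A _ ?B])
      (simp_all add: lookup_add algebra_simps F.scale_left_distrib sum.distrib)
qed

lemma fbracket_scale: "fbracket (fscale c f) g = fscale c (fbracket f g)"
  using keys_fscale[of c f]
  by (subst (1 2) fbracket_superset[of "Poly_Mapping.keys f" _ "Poly_Mapping.keys g"])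
    (simp_all add: F.scale_sum_right mult.assoc)

lemma fbracket_central:
  assumes "Poly_Mapping.keys f \<subseteq> {Zc}"
  shows "fbracket f g = 0" "fbracket g f = 0"
proof -
  show "fbracket f g = 0"
    by (subst fbracket_superset[OF _ assms finite_keys subset_refl]) simp_all
  then show "fbracket g f = 0" by (simp add: fbracket_commute)
qed

lemma keys_fbracket: "Poly_Mapping.keys (fbracket f g) \<subseteq> {Zc}"
proof -
  have "Poly_Mapping.lookup (basis_bracket a b) (Psi r) = 0" for a b r
    by (cases a; cases b) (auto simp: fz_def lookup_single)
  then have "Poly_Mapping.lookup (fbracket f g) (Psi r) = 0" for r
    by (simp add: fbracket_def lookup_sum)
  then show ?thesis
    by (metis fermion_basis.exhaust in_keys_iff insertI1 subsetI)
qed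

lemma subspace_fermion_comp: "F.subspace (fermion_comp I i)"
  unfolding F.subspace_def fermion_comp_def
  using keys_fscale Poly_Mapping.keys_add by (fastforce simp: subset_iff)

theorem lie_superalgebra_fermion: "lie_superalgebra fscale (fermion_comp I) fbracket"
proof
  show "F.subspace (fermion_comp I i)" for i by (rule subspace_fermion_comp)
  show "fermion_comp I 0 \<inter> fermion_comp I 1 = {0}"
    by (auto simp: fermion_comp_def subset_iff) (metis fermion_basis.simps(3) imageE in_keys_iff
        lookup_zero poly_mapping_eqI)
  show "fbracket x (y + y') = fbracket x y + fbracket x y'" for x y y'
    by (metis fbracket_add fbracket_commute)
  show "fbracket x (fscale c y) = fscale c (fbracket x y)" for x y c
    by (metis fbracket_scale fbracket_commute)
next
  fix x y :: fermion and i j :: bit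
  assume x: "x \<in> fermion_comp I i" and y: "y \<in> fermion_comp I j"
  have zero: "fbracket x y = 0" if "\<not> (i = 1 \<and> j = 1)"
    using x y that fbracket_central[of x y] fbracket_central[of y x]
    by (auto simp: fermion_comp_def split: if_splits)
  show "fbracket x y \<in> fermion_comp I (i + j)"
    using zero keys_fbracket[of x y] by (cases "i = 1 \<and> j = 1") (auto simp: fermion_comp_def)
  show "fbracket x y = - fscale (super_sign i j) (fbracket y x)"
    using zero by (cases "i = 1 \<and> j = 1") (auto simp: super_sign_def fbracket_commute[of y x])
next
  fix x y z :: fermion and i j :: bit
  show "fbracket x (fbracket y z) = fbracket (fbracket x y) z
      + fscale (super_sign i j) (fbracket y (fbracket x z))"
    by (simp add: fbracket_central[OF keys_fbracket])
qed (simp_all add: fbracket_add fbracket_scale)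

theorem lie_superalgebra_fermion_alg: "lie_superalgebra fscale (fermion_alg \<delta>) fbracket"
  by (simp add: fermion_alg_def lie_superalgebra_fermion)

theorem fermion_fin_subalgebra:
  "lie_subsuperalgebra fscale (fermion_alg 0) fbracket (fermion_fin m)"
proof -
  interpret lie_superalgebra fscale "fermion_alg 0" fbracket
    by (rule lie_superalgebra_fermion_alg)
  show ?thesis
  proof
    show "F.subspace (fermion_fin m i)" for i
      by (simp add: fermion_fin_def subspace_fermion_comp)
    show "fermion_fin m i \<subseteq> fermion_alg 0 i" for i
      by (auto simp: fermion_fin_def fermion_alg_def fermion_comp_def)
    show "fbracket x y \<in> super_carrier (fermion_fin m)" for x y
    proof -
      have "fbracket x y = fbracket x y + 0" "fbracket x y \<in> fermion_fin m 0" "0 \<in> fermion_fin m 1"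
        using keys_fbracket by (auto simp: fermion_fin_def fermion_comp_def)
      then show ?thesis unfolding super_carrier_def by blast
    qed
  qed
qed

subsection \<open>The stated bases\<close>

lemma fermion_independent: "F.independent (insert fz (range psi))"
proof -
  have inj: "inj (\<lambda>a. Poly_Mapping.single a (1::complex))"
    by (rule injI) (metis lookup_single_eq lookup_single_not_eq one_neq_zero)
  have *: "insert fz (range psi) = range (\<lambda>a. Poly_Mapping.single a (1::complex))"
    unfolding fz_def psi_def image_def by (auto; metis fermion_basis.exhaust)
  show ?thesis
    unfolding * F.dependent_explicit
  proof clarify
    fix t u v
    assume fin: "finite t" and t: "t \<subseteq> range (\<lambda>a. Poly_Mapping.single a (1::complex))"
      and s: "(\<Sum>w\<in>t. fscale (u w) w) = 0" and v: "v \<in> t" "u v \<noteq> 0"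
    obtain a where a: "v = Poly_Mapping.single a 1" using t v by auto
    have "Poly_Mapping.lookup w a = (if w = v then 1 else 0)" if "w \<in> t" for w
      using that t a inj by (auto simp: lookup_single when_def)
    then have "Poly_Mapping.lookup (\<Sum>w\<in>t. fscale (u w) w) a = (\<Sum>w\<in>t. if w = v then u w else 0)"
      by (auto simp: lookup_sum intro!: sum.cong)
    also have "\<dots> = u v" using fin v by simp
    finally show False using s v by simp
  qed
qed

lemma inj_psi: "inj psi"
  by (rule injI) (metis fermion_basis.inject lookup_single_eq lookup_single_not_eq one_neq_zero psi_def)

lemma fz_not_psi: "fz \<notin> range psi"
  by (auto simp: fz_def psi_def) (metis fermion_basis.distinct(1) lookup_single_eq lookup_single_not_eq one_neq_zero)

lemma fermion_span: "super_carrier (fermion_comp I) = F.span (insert fz (psi ` I))"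
proof
  have gen: "Poly_Mapping.single a 1 \<in> F.span (insert fz (psi ` I))"
    if "a \<in> insert Zc (Psi ` I)" for a
    using that by (auto intro!: F.span_base simp: fz_def psi_def)
  have in_span: "f \<in> F.span (insert fz (psi ` I))"
    if "Poly_Mapping.keys f \<subseteq> insert Zc (Psi ` I)" for f
  proof -
    have "f = (\<Sum>a\<in>Poly_Mapping.keys f.
        fscale (Poly_Mapping.lookup f a) (Poly_Mapping.single a 1))"
      by (rule poly_mapping_eqI)
        (simp add: lookup_sum lookup_single when_def if_distrib in_keys_iff cong: if_cong)
    moreover have "\<dots> \<in> F.span (insert fz (psi ` I))"
      using that by (intro F.span_sum F.span_scale gen) auto
    ultimately show ?thesis by simp
  qed
  show "super_carrier (fermion_comp I) \<subseteq> F.span (insert fz (psi ` I))"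
  proof
    fix f assume "f \<in> super_carrier (fermion_comp I)"
    then obtain a b where "f = a + b" "Poly_Mapping.keys a \<subseteq> {Zc}"
        "Poly_Mapping.keys b \<subseteq> Psi ` I"
      by (auto simp: super_carrier_def fermion_comp_def)
    then show "f \<in> F.span (insert fz (psi ` I))"
      using in_span[of a] in_span[of b] by (auto intro: F.span_add)
  qed
next
  have comp: "F.subspace {a + b | a b. a \<in> fermion_comp I 0 \<and> b \<in> fermion_comp I 1}"
    by (intro F.subspace_sums subspace_fermion_comp)
  have "insert fz (psi ` I) \<subseteq> super_carrier (fermion_comp I)"
  proof
    fix f assume "f \<in> insert fz (psi ` I)"
    then have "f \<in> fermion_comp I 0 \<or> f \<in> fermion_comp I 1"
      by (auto simp: fermion_comp_def fz_def psi_def)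
    moreover have "0 \<in> fermion_comp I i" for i by (simp add: fermion_comp_def)
    ultimately show "f \<in> super_carrier (fermion_comp I)"
      unfolding super_carrier_def by (metis (mono_tags, lifting) add.left_neutral add.right_neutral mem_Collect_eq)
  qed
  then show "F.span (insert fz (psi ` I)) \<subseteq> super_carrier (fermion_comp I)"
    using comp by (intro F.span_minimal) (simp_all add: super_carrier_def)
qed

end

theory Submission
  imports Defs
begin

text \<open>
  Since \<open>z\<close> acts by zero, every odd \<open>x\<close> supercommutes with the whole algebra on \<open>V\<close> and squares
  to zero there. Its kernel is therefore a graded submodule: it is \<open>V\<close>, or it is zero, and in the
  latter case \<open>x V\<close>, which lies in the kernel, is zero as well. Once the
  action is trivial, the line through a nonzero homogeneous vector is a graded submodule.
\<close>

section \<open>Superspaces: inclusion and independence of the two components\<close>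

context superspace
begin

lemma component_subset_super_carrier: "V i \<subseteq> super_carrier V"
proof
  fix v assume v: "v \<in> V i"
  have "0 \<in> V j" for j
    using subspace_0[OF subspace_component] .
  then show "v \<in> super_carrier V"
    using v unfolding super_carrier_def
    by (cases i) (metis (mono_tags, lifting) add_0 add_0_right mem_Collect_eq)+
qed

lemma subspace_super_carrier: "subspace (super_carrier V)"
  unfolding super_carrier_def by (intro subspace_sums subspace_component)

lemma super_carrierE:
  assumes "v \<in> super_carrier V"
  obtains a b where "a \<in> V 0" "b \<in> V 1" "v = a + b"
  using assms by (auto simp: super_carrier_def)

text \<open>Trivial intersection makes the sum direct: \<open>a = - b\<close> puts \<open>a\<close>
  in both components.\<close>

lemma components_independent:
  assumes "a \<in> V 0" "b \<in> V 1" "a + b = 0"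
  shows "a = 0 \<and> b = 0"
proof -
  have "a = - b"
    using assms(3) by (simp add: eq_neg_iff_add_eq_0)
  then have "a \<in> V 0 \<inter> V 1"
    using assms subspace_neg[OF subspace_component] by auto
  then show ?thesis
    using components_disjoint assms(3) by simp
qed

lemma exists_homogeneous_nonzero:
  assumes "super_carrier V \<noteq> {0}"
  obtains i v where "v \<in> V i" "v \<noteq> 0"
proof -
  obtain v where "v \<in> super_carrier V" "v \<noteq> 0"
    using assms subspace_0[OF subspace_super_carrier] by blast
  then show thesis
    by (metis add_0 super_carrierE that)
qed

end

section \<open>Graded submodules and kernels of homogeneous elements\<close>

context lie_supermodule
begin

text \<open>Follows from \<open>act_graded\<close> on the four pairs of homogeneous parts. Iterated
  actions rely on it, since the module axioms speak only of vectors in the carrier.\<close>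

lemma act_in_super_carrier:
  assumes "x \<in> super_carrier G" "v \<in> super_carrier V"
  shows "act x v \<in> super_carrier V"
proof -
  obtain a b where a: "a \<in> G 0" and b: "b \<in> G 1" and x: "x = a + b"
    using assms(1) by (rule alg.super_carrierE)
  obtain c d where c: "c \<in> V 0" and d: "d \<in> V 1" and v: "v = c + d"
    using assms(2) by (rule super_carrierE)
  have G: "a \<in> super_carrier G" "b \<in> super_carrier G"
    using a b alg.component_subset_super_carrier by blast+
  have V: "c \<in> super_carrier V" "d \<in> super_carrier V"
    using c d component_subset_super_carrier by blast+
  have "act x v = (act a c + act a d) + (act b c + act b d)"
    using G V assms(2) by (simp add: x v act_add_left act_add_right)
  then show ?thesis
    using act_graded[OF a c] act_graded[OF a d] act_graded[OF b c] act_graded[OF b d]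
      component_subset_super_carrier
    by (auto intro!: subspace_add[OF subspace_super_carrier])
qed

lemma act_zero_right: "x \<in> super_carrier G \<Longrightarrow> act x 0 = 0"
  using act_add_right[of x 0 0] subspace_0[OF subspace_super_carrier] by simp

text \<open>Trades the set equation in \<open>graded_submodule\<close> for a test on vectors: the
  homogeneous parts of each element of \<open>W\<close> stay in \<open>W\<close>.\<close>

lemma graded_submoduleI:
  assumes "subspace W" "W \<subseteq> super_carrier V"
    and "\<And>a b. a \<in> V 0 \<Longrightarrow> b \<in> V 1 \<Longrightarrow> a + b \<in> W \<Longrightarrow> a \<in> W \<and> b \<in> W"
    and "\<And>x w. x \<in> super_carrier G \<Longrightarrow> w \<in> W \<Longrightarrow> act x w \<in> W"
  shows "graded_submodule W"
proof -
  have "W = super_carrier (\<lambda>i. W \<inter> V i)"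
  proof
    show "W \<subseteq> super_carrier (\<lambda>i. W \<inter> V i)"
    proof
      fix w assume w: "w \<in> W"
      then obtain a b where ab: "a \<in> V 0" "b \<in> V 1" "w = a + b"
        using assms(2) super_carrierE by blast
      moreover from ab w have "a \<in> W" "b \<in> W" using assms(3) by blast+
      ultimately show "w \<in> super_carrier (\<lambda>i. W \<inter> V i)"
        by (auto simp: super_carrier_def)
    qed
    show "super_carrier (\<lambda>i. W \<inter> V i) \<subseteq> W"
      using subspace_add[OF assms(1)] by (auto simp: super_carrier_def)
  qed
  then show ?thesis
    using assms by (simp add: graded_submodule_def)
qed

text \<open>As \<open>bracket x y\<close> acts by zero, \<open>x\<close> and a homogeneous
  \<open>y\<close> commute up to sign on the carrier, so \<open>x y v\<close> is a multiple of
  \<open>y x v = 0\<close>. The kernel is graded because \<open>x\<close> is homogeneous.\<close>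

lemma graded_submodule_kernel:
  assumes x: "x \<in> G i"
    and br: "\<And>y v. y \<in> super_carrier G \<Longrightarrow> v \<in> super_carrier V \<Longrightarrow> act (bracket x y) v = 0"
  shows "graded_submodule {v \<in> super_carrier V. act x v = 0}" (is "graded_submodule ?K")
proof (rule graded_submoduleI)
  have xG: "x \<in> super_carrier G"
    using x alg.component_subset_super_carrier by blast
  show "?K \<subseteq> super_carrier V" by blast
  show sub: "subspace ?K"
    using xG subspace_super_carrier
    by (auto simp: subspace_def act_zero_right act_add_right act_scale_right)
  show "a \<in> ?K \<and> b \<in> ?K" if a: "a \<in> V 0" and b: "b \<in> V 1" and ab: "a + b \<in> ?K" for a b
  proof -
    have V: "a \<in> super_carrier V" "b \<in> super_carrier V"
      using a b component_subset_super_carrier by blast+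
    have s: "act x a + act x b = 0"
      using ab V xG by (simp add: act_add_right)
    have "act x a \<in> V i" "act x b \<in> V (i + 1)"
      using act_graded[OF x a] act_graded[OF x b] by (simp_all only: add_0_right)
    \<comment> \<open>The two images have opposite parities; which one is even depends on
      \<open>i\<close>, hence both orders of the summands.\<close>
    then have "act x a = 0 \<and> act x b = 0"
      using s components_independent[of "act x a" "act x b"]
        components_independent[of "act x b" "act x a"]
      by (cases i) (auto simp: add.commute)
    then show ?thesis using V by simp
  qed
  \<comment> \<open>\<open>act_bracket\<close> covers homogeneous \<open>y\<close> only; a general
    \<open>y\<close> is split into its parts afterwards.\<close>
  have homogeneous: "act y v \<in> ?K" if y: "y \<in> G j" and v: "v \<in> ?K" for y j v
  proof -
    have yG: "y \<in> super_carrier G"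
      using y alg.component_subset_super_carrier by blast
    have "act (bracket x y) v = act x (act y v) - scale (super_sign i j) (act y (act x v))"
      using act_bracket[OF x y] v by blast
    then show ?thesis
      using v yG br act_in_super_carrier by (simp add: act_zero_right)
  qed
  show "act y v \<in> ?K" if y: "y \<in> super_carrier G" and v: "v \<in> ?K" for y v
  proof -
    obtain a b where ab: "a \<in> G 0" "b \<in> G 1" "y = a + b"
      using y by (rule alg.super_carrierE)
    have "act y v = act a v + act b v"
      using ab v alg.component_subset_super_carrier by (auto intro!: act_add_left)
    then show ?thesis
      using homogeneous[OF ab(1) v] homogeneous[OF ab(2) v] subspace_add[OF sub] by simp
  qed
qed

end

section \<open>Consequences of simplicity\<close>

context simple_lie_supermodule
begin

lemma odd_act_eq_zero:
  assumes x: "x \<in> G 1"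
    and br: "\<And>y v. y \<in> super_carrier G \<Longrightarrow> v \<in> super_carrier V \<Longrightarrow> act (bracket x y) v = 0"
    and v: "v \<in> super_carrier V"
  shows "act x v = 0"
proof -
  let ?K = "{v \<in> super_carrier V. act x v = 0}"
  have xG: "x \<in> super_carrier G"
    using x alg.component_subset_super_carrier by blast
  \<comment> \<open>For odd \<open>x\<close> the sign is -1, so \<open>bracket x x\<close> acts as
    twice the square of \<open>x\<close>; cancelling 2 puts \<open>act x v\<close> in the
    kernel.\<close>
  have "scale 2 (act x (act x v)) = act x (act x v) + act x (act x v)"
    using scale_left_distrib[of 1 1 "act x (act x v)"] by simp
  also have "\<dots> = act (bracket x x) v"
    using act_bracket[OF x x v] by (simp add: super_sign_def)
  finally have "act x v \<in> ?K"
    using br xG v act_in_super_carrier by simp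
  moreover have "?K = {0} \<or> ?K = super_carrier V"
    using no_proper_submodule graded_submodule_kernel[OF x br] by blast
  \<comment> \<open>If \<open>?K = {0}\<close>, then \<open>act x v\<close>, a member of
    \<open>?K\<close>, is zero; otherwise \<open>v\<close> itself lies in \<open>?K\<close>.\<close>
  ultimately show ?thesis
    using v by blast
qed

lemma dim_eq_1_if_trivial_action:
  assumes triv: "\<And>x v. x \<in> super_carrier G \<Longrightarrow> v \<in> super_carrier V \<Longrightarrow> act x v = 0"
  shows "dim (super_carrier V) = 1"
proof -
  obtain i v where v: "v \<in> V i" "v \<noteq> 0"
    using nonzero by (rule exists_homogeneous_nonzero)
  have sub: "span {v} \<subseteq> V i"
    using v subspace_component by (intro span_minimal) auto
  have carrier: "span {v} \<subseteq> super_carrier V"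
    using sub component_subset_super_carrier by blast
  have "graded_submodule (span {v})"
  proof (rule graded_submoduleI)
    show "a \<in> span {v} \<and> b \<in> span {v}"
      if a: "a \<in> V 0" and b: "b \<in> V 1" and ab: "a + b \<in> span {v}" for a b
    \<comment> \<open>The line lies in a single component \<open>V i\<close>. Subtracting the part
      of parity \<open>i\<close> from \<open>a + b\<close> puts the other part in both components,
      so it vanishes.\<close>
    proof (cases i)
      case zero
      then have "b \<in> V 0"
        using ab a sub subspace_diff[OF subspace_component, of "a + b" 0 a] by auto
      then have "b = 0" using b components_disjoint by blast
      then show ?thesis using ab span_zero by simp
    next
      case one
      then have "a \<in> V 1"
        using ab b sub subspace_diff[OF subspace_component, of "a + b" 1 b] by auto
      then have "a = 0" using a components_disjoint by blast
      then show ?thesis using ab span_zero by simp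
    qed
    show "act x w \<in> span {v}" if "x \<in> super_carrier G" "w \<in> span {v}" for x w
      using triv that carrier span_zero by (metis subsetD)
  qed (use carrier in simp_all)
  then have "span {v} = super_carrier V"
    using no_proper_submodule v span_base[of v "{v}"] by blast
  then have "dim (super_carrier V) = dim {v}"
    using dim_span by metis
  also have "\<dots> = 1"
    using v dim_eq_card_independent[of "{v}"] by simp
  finally show ?thesis .
qed

end

section \<open>Application to the Fermion algebras\<close>

lemma fermion_even_eq: "Poly_Mapping.keys f \<subseteq> {Zc} \<Longrightarrow> f = fscale (Poly_Mapping.lookup f Zc) fz"
  by (rule poly_mapping_eqI) (auto simp: fz_def lookup_single when_def in_keys_iff)

text \<open>The argument is blind to the index set: the even part of \<open>fermion_comp I\<close>
  is the line through \<open>fz\<close>, and every bracket falls in it. Both families of algebras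
  are instances.\<close>

lemma fermion_comp_trivial_action:
  assumes "simple_lie_supermodule fscale (fermion_comp I) fbracket scale V act"
    and z: "\<forall>v\<in>super_carrier V. act fz v = 0"
  shows "(\<forall>x\<in>super_carrier (fermion_comp I). \<forall>v\<in>super_carrier V. act x v = 0) \<and>
    vector_space.dim scale (super_carrier V) = 1"
proof -
  interpret simple_lie_supermodule fscale "fermion_comp I" fbracket scale V act
    by (rule assms(1))
  have fz: "fz \<in> super_carrier (fermion_comp I)"
    by (simp add: fermion_span F.span_base)
  have even: "act x v = 0" if "Poly_Mapping.keys x \<subseteq> {Zc}" "v \<in> super_carrier V" for x v
    using that z fz by (subst fermion_even_eq) (simp_all add: act_scale_left)
  have triv: "act x v = 0"
    if x: "x \<in> super_carrier (fermion_comp I)" and v: "v \<in> super_carrier V" for x v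
  proof -
    obtain a b where ab: "a \<in> fermion_comp I 0" "b \<in> fermion_comp I 1" "x = a + b"
      using x by (rule alg.super_carrierE)
    have "act x v = act a v + act b v"
      using ab v alg.component_subset_super_carrier by (auto intro!: act_add_left)
    moreover have "act a v = 0"
      using ab(1) v by (intro even) (simp_all add: fermion_comp_def)
    \<comment> \<open>By \<open>keys_fbracket\<close> each bracket with \<open>b\<close> is a
      multiple of \<open>fz\<close>, hence acts by zero, as \<open>odd_act_eq_zero\<close>
      requires.\<close>
    moreover have "act b v = 0"
      using ab(2) even[OF keys_fbracket] v by (rule odd_act_eq_zero)
    ultimately show ?thesis by simp
  qed
  then show ?thesis
    using dim_eq_1_if_trivial_action by blast
qed

theorem lemma3p4:
  fixes scale :: "complex \<Rightarrow> 'v::ab_group_add \<Rightarrow> 'v"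
    and V :: "bit \<Rightarrow> 'v set"
    and act :: "fermion \<Rightarrow> 'v \<Rightarrow> 'v"
  shows "(\<forall>m::nat.
            simple_lie_supermodule fscale (fermion_fin m) fbracket scale V act \<longrightarrow>
            (\<forall>v\<in>super_carrier V. act fz v = 0) \<longrightarrow>
              (\<forall>x\<in>super_carrier (fermion_fin m). \<forall>v\<in>super_carrier V. act x v = 0) \<and>
              vector_space.dim scale (super_carrier V) = 1)
       \<and> (\<forall>\<delta>\<in>{0, 1/2}.
            simple_lie_supermodule fscale (fermion_alg \<delta>) fbracket scale V act \<longrightarrow>
            (\<forall>v\<in>super_carrier V. act fz v = 0) \<longrightarrow>
              (\<forall>x\<in>super_carrier (fermion_alg \<delta>). \<forall>v\<in>super_carrier V. act x v = 0) \<and>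
              vector_space.dim scale (super_carrier V) = 1)"
  unfolding fermion_fin_def fermion_alg_def
  using fermion_comp_trivial_action by blast

end
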